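(* Let $\Pi$ be a maximization problem with an online version, let $A_{\mathrm{off}}$ be an offline algorithm for $\Pi$ with approximation ratio $\alpha$, and let $A_{\mathrm{on}}$ be a flexible online algorithm that is compatible with $A_{\mathrm{off}}$ with maintaining ratio $\beta$ and migration factor $\gamma$. Let $F$ be the combined algorithm, which works as follows: - At the start it uses the solution of $A_{\mathrm{off}}$. - Between repacking times it runs $A_{\mathrm{on}}$, starting from the solution computed at the last repacking time. - At each $(\beta,\gamma)$-repacking time $t^\star$ it switches to the solution $A_{\mathrm{off}}(I_{t^\star})$. Then $F$ is an online algorithm with competitive ratio $\alpha\cdot\beta$ and amortized migration factor $\gamma$.
   Context: Online model: an online instance is a sequence of instances $I_0,I_1,\dots$, changing by one event per time step. Solutions have profits, $\mathrm{opt}(I_t)$ is the optimum profit, and competitive ratio $c$ means $\mathrm{profit}(S_t)\ge c\,\mathrm{opt}(I_t)$ for all $t$. Each step $t$ carries a migration potential $\Delta(I_t)$, and $\Delta_{t:t'}$ is the total potential of steps $t+1,\dots,t'$. Changing solution $S$ to $S'$ has migration cost $\phi(S\to S')$. The amortized migration factor is $\gamma$ if the total migration cost up to any time $t$ is at most $\gamma\Delta_{0:t}$. An offline algorithm has approximation ratio $\alpha$ if $A_{\mathrm{off}}(I)\ge\alpha\,\mathrm{opt}(I)$. Flexible: an online algorithm $A_{\mathrm{on}}$ is flexible if, given a time $t$ and any solution $S_t$ for $I_t$ (not necessarily produced by $A_{\mathrm{on}}$), it extends $S_t$ to solutions $S_{t'}$ for $I_{t'}$, $t'>t$, by reacting to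 the events after $t$. It has maintaining ratio $\beta$ from $t$ to $t'$ if $\mathrm{profit}(S_t)=A_{\mathrm{off}}(I_t)\ge\alpha\,\mathrm{opt}(I_t)$ implies $\mathrm{profit}(S_{t'})\ge\alpha\beta\,\mathrm{opt}(I_{t'})$. Repacking time: let $t$ be a time, $S_t$ a solution for $I_t$, and $t'$ the first time at which $A_{\mathrm{on}}$ started from $S_t$ fails to keep maintaining ratio $\beta$. A time $t^\star$ with $t<t^\star\le t'$ is a $(\beta,\gamma)$-repacking time (for a solution $S'_{t^\star}$) if $S'_{t^\star}$ is a $\beta$-competitive solution with $\phi(S_{t^\star-1}\to S'_{t^\star})/\Delta_{t:t^\star}\le\gamma$, where $S_{t^\star-1}$ is the solution of $A_{\mathrm{on}}$ at time $t^\star-1$. Compatible: $A_{\mathrm{on}}$ and $A_{\mathrm{off}}$ are compatible with maintaining ratio $\beta$ and migration factor $\gamma$ if $A_{\mathrm{on}}$, started from any solution produced by $A_{\mathrm{off}}$, admits a $(\beta,\gamma)$-repacking time for some future solution of $A_{\mathrm{off}}$.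
   Formalization: The online algorithm's own steps are assumed to cost no migration ("extends" read as: without migration), since otherwise the migration bound fails; profits, potentials and migration costs are taken nonnegative, with α ≥ 0 and β ≤ 1. *)

theory Defs
  imports Complex_Main "HOL-Library.Extended_Nat"
begin

text \<open>
  A maximization problem with its online version. \<open>event P J J'\<close> says that \<open>J'\<close> arises from
  \<open>J\<close> by one event, and \<open>initial P\<close> are the instances with which an online instance may start.
  \<open>migration P S S'\<close> is the cost of changing \<open>S\<close> to \<open>S'\<close>, where \<open>S\<close> and \<open>S'\<close> may belong to
  different instances.
\<close>

record ('i, 's) online_problem =
  instances :: "'i set"
  solutions :: "'i \<Rightarrow> 's set"
  profit :: "'s \<Rightarrow> real"
  initial :: "'i set"
  event :: "'i \<Rightarrow> 'i \<Rightarrow> bool"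
  potential :: "'i \<Rightarrow> real"
  migration :: "'s \<Rightarrow> 's \<Rightarrow> real"

definition opt :: "('i, 's) online_problem \<Rightarrow> 'i \<Rightarrow> real" where
  "opt P J = (SUP S\<in>solutions P J. profit P S)"

text \<open>The first two conditions on solutions make the supremum in \<open>opt\<close> meaningful.\<close>

definition online_max_problem :: "('i, 's) online_problem \<Rightarrow> bool" where
  "online_max_problem P \<longleftrightarrow>
     (\<forall>J\<in>instances P.
        solutions P J \<noteq> {} \<and> bdd_above (profit P ` solutions P J) \<and>
        (\<forall>S\<in>solutions P J. 0 \<le> profit P S) \<and> 0 \<le> potential P J) \<and>
     (\<forall>J\<in>instances P. \<forall>J'\<in>instances P. \<forall>S\<in>solutions P J. \<forall>S'\<in>solutions P J'.
        0 \<le> migration P S S')"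

definition online_instances :: "('i, 's) online_problem \<Rightarrow> (nat \<Rightarrow> 'i) set" where
  "online_instances P =
     {I. I 0 \<in> initial P \<and> (\<forall>t. I t \<in> instances P) \<and> (\<forall>t. event P (I t) (I (Suc t)))}"

text \<open>The total potential of the steps \<open>t + 1, \<dots>, t'\<close>.\<close>

definition total_potential ::
  "('i, 's) online_problem \<Rightarrow> (nat \<Rightarrow> 'i) \<Rightarrow> nat \<Rightarrow> nat \<Rightarrow> real" where
  "total_potential P I t t' = (\<Sum>u\<in>{t<..t'}. potential P (I u))"

text \<open>
  An online algorithm maps an online instance and a time to a solution. The second condition
  says that the solution at time \<open>t\<close> depends on the instances up to time \<open>t\<close> only.
\<close>

definition online_algorithm ::
  "('i, 's) online_problem \<Rightarrow> ((nat \<Rightarrow> 'i) \<Rightarrow> nat \<Rightarrow> 's) \<Rightarrow> bool" where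
  "online_algorithm P A \<longleftrightarrow>
     (\<forall>I\<in>online_instances P. \<forall>t. A I t \<in> solutions P (I t)) \<and>
     (\<forall>I\<in>online_instances P. \<forall>I'\<in>online_instances P. \<forall>t.
        (\<forall>u\<le>t. I u = I' u) \<longrightarrow> A I t = A I' t)"

definition competitive_ratio ::
  "('i, 's) online_problem \<Rightarrow> ((nat \<Rightarrow> 'i) \<Rightarrow> nat \<Rightarrow> 's) \<Rightarrow> real \<Rightarrow> bool" where
  "competitive_ratio P A c \<longleftrightarrow>
     (\<forall>I\<in>online_instances P. \<forall>t. profit P (A I t) \<ge> c * opt P (I t))"

definition amortized_migration_factor ::
  "('i, 's) online_problem \<Rightarrow> ((nat \<Rightarrow> 'i) \<Rightarrow> nat \<Rightarrow> 's) \<Rightarrow> real \<Rightarrow> bool" where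
  "amortized_migration_factor P A \<gamma> \<longleftrightarrow>
     (\<forall>I\<in>online_instances P. \<forall>t.
        (\<Sum>u<t. migration P (A I u) (A I (Suc u))) \<le> \<gamma> * total_potential P I 0 t)"

definition offline_algorithm :: "('i, 's) online_problem \<Rightarrow> ('i \<Rightarrow> 's) \<Rightarrow> bool" where
  "offline_algorithm P A \<longleftrightarrow> (\<forall>J\<in>instances P. A J \<in> solutions P J)"

definition approximation_ratio ::
  "('i, 's) online_problem \<Rightarrow> ('i \<Rightarrow> 's) \<Rightarrow> real \<Rightarrow> bool" where
  "approximation_ratio P A \<alpha> \<longleftrightarrow> (\<forall>J\<in>instances P. profit P (A J) \<ge> \<alpha> * opt P J)"

text \<open>
  \<open>A_on t S I t'\<close> is the solution for \<open>I t'\<close> at time \<open>t' \<ge> t\<close> if the algorithm is started at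
  time \<open>t\<close> from the solution \<open>S\<close> for \<open>I t\<close>. That solutions are only extended is the condition
  that the steps of the algorithm have migration cost 0.
\<close>

definition flexible ::
  "('i, 's) online_problem \<Rightarrow> (nat \<Rightarrow> 's \<Rightarrow> (nat \<Rightarrow> 'i) \<Rightarrow> nat \<Rightarrow> 's) \<Rightarrow> bool" where
  "flexible P A_on \<longleftrightarrow>
     (\<forall>I\<in>online_instances P. \<forall>t. \<forall>S\<in>solutions P (I t).
        A_on t S I t = S \<and>
        (\<forall>t'\<ge>t.
           A_on t S I t' \<in> solutions P (I t') \<and>
           migration P (A_on t S I t') (A_on t S I (Suc t')) = 0 \<and>
           (\<forall>I'\<in>online_instances P.
              (\<forall>u\<le>t'. I u = I' u) \<longrightarrow> A_on t S I t' = A_on t S I' t')))"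

definition maintains_ratio ::
  "('i, 's) online_problem \<Rightarrow> ('i \<Rightarrow> 's) \<Rightarrow> (nat \<Rightarrow> 's \<Rightarrow> (nat \<Rightarrow> 'i) \<Rightarrow> nat \<Rightarrow> 's) \<Rightarrow>
   real \<Rightarrow> real \<Rightarrow> (nat \<Rightarrow> 'i) \<Rightarrow> nat \<Rightarrow> 's \<Rightarrow> nat \<Rightarrow> bool" where
  "maintains_ratio P A_off A_on \<alpha> \<beta> I t S t' \<longleftrightarrow>
     (profit P S = profit P (A_off (I t)) \<and> profit P (A_off (I t)) \<ge> \<alpha> * opt P (I t) \<longrightarrow>
      profit P (A_on t S I t') \<ge> \<alpha> * \<beta> * opt P (I t'))"

text \<open>The value is \<open>\<infinity>\<close> if the ratio is maintained forever.\<close>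

definition first_failure ::
  "('i, 's) online_problem \<Rightarrow> ('i \<Rightarrow> 's) \<Rightarrow> (nat \<Rightarrow> 's \<Rightarrow> (nat \<Rightarrow> 'i) \<Rightarrow> nat \<Rightarrow> 's) \<Rightarrow>
   real \<Rightarrow> real \<Rightarrow> (nat \<Rightarrow> 'i) \<Rightarrow> nat \<Rightarrow> 's \<Rightarrow> enat" where
  "first_failure P A_off A_on \<alpha> \<beta> I t S =
     (INF t'\<in>{t'. t < t' \<and> \<not> maintains_ratio P A_off A_on \<alpha> \<beta> I t S t'}. enat t')"

text \<open>
  The bound on the migration cost divided by the total potential is multiplied out: for total
  potential 0 it allows cost 0 only, whereas division by 0 would yield 0 for every cost.
\<close>

definition repacking_time ::
  "('i, 's) online_problem \<Rightarrow> ('i \<Rightarrow> 's) \<Rightarrow> (nat \<Rightarrow> 's \<Rightarrow> (nat \<Rightarrow> 'i) \<Rightarrow> nat \<Rightarrow> 's) \<Rightarrow>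
   real \<Rightarrow> real \<Rightarrow> real \<Rightarrow> (nat \<Rightarrow> 'i) \<Rightarrow> nat \<Rightarrow> 's \<Rightarrow> nat \<Rightarrow> 's \<Rightarrow> bool" where
  "repacking_time P A_off A_on \<alpha> \<beta> \<gamma> I t S r S' \<longleftrightarrow>
     t < r \<and> enat r \<le> first_failure P A_off A_on \<alpha> \<beta> I t S \<and>
     S' \<in> solutions P (I r) \<and> profit P S' \<ge> \<beta> * opt P (I r) \<and>
     migration P (A_on t S I (r - 1)) S' \<le> \<gamma> * total_potential P I t r"

definition compatible ::
  "('i, 's) online_problem \<Rightarrow> ('i \<Rightarrow> 's) \<Rightarrow> (nat \<Rightarrow> 's \<Rightarrow> (nat \<Rightarrow> 'i) \<Rightarrow> nat \<Rightarrow> 's) \<Rightarrow>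
   real \<Rightarrow> real \<Rightarrow> real \<Rightarrow> bool" where
  "compatible P A_off A_on \<alpha> \<beta> \<gamma> \<longleftrightarrow>
     (\<forall>I\<in>online_instances P. \<forall>t. \<exists>r.
        repacking_time P A_off A_on \<alpha> \<beta> \<gamma> I t (A_off (I t)) r (A_off (I r)))"

text \<open>The last time at or before the given one at which the combined algorithm used \<open>A_off\<close>.\<close>

primrec last_repacking ::
  "('i, 's) online_problem \<Rightarrow> ('i \<Rightarrow> 's) \<Rightarrow> (nat \<Rightarrow> 's \<Rightarrow> (nat \<Rightarrow> 'i) \<Rightarrow> nat \<Rightarrow> 's) \<Rightarrow>
   real \<Rightarrow> real \<Rightarrow> real \<Rightarrow> (nat \<Rightarrow> 'i) \<Rightarrow> nat \<Rightarrow> nat" where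
  "last_repacking P A_off A_on \<alpha> \<beta> \<gamma> I 0 = 0"
| "last_repacking P A_off A_on \<alpha> \<beta> \<gamma> I (Suc t) =
     (let l = last_repacking P A_off A_on \<alpha> \<beta> \<gamma> I t in
      if repacking_time P A_off A_on \<alpha> \<beta> \<gamma> I l (A_off (I l)) (Suc t) (A_off (I (Suc t)))
      then Suc t else l)"

definition combined ::
  "('i, 's) online_problem \<Rightarrow> ('i \<Rightarrow> 's) \<Rightarrow> (nat \<Rightarrow> 's \<Rightarrow> (nat \<Rightarrow> 'i) \<Rightarrow> nat \<Rightarrow> 's) \<Rightarrow>
   real \<Rightarrow> real \<Rightarrow> real \<Rightarrow> (nat \<Rightarrow> 'i) \<Rightarrow> nat \<Rightarrow> 's" where
  "combined P A_off A_on \<alpha> \<beta> \<gamma> I t =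
     (let l = last_repacking P A_off A_on \<alpha> \<beta> \<gamma> I t in
      if l = t then A_off (I t) else A_on l (A_off (I l)) I t)"

end

(*
  Starting from a repacking time l, compatibility provides a repacking time no later than the first
  failure of A_on. The combined algorithm switches at the first repacking time after l, so between
  two switches the ratio \<alpha> * \<beta> is never lost. Migration is paid at the switches only, and the cost
  of a switch is charged to the potential of the phase that it ends; the potential of the unfinished
  phase is slack.
*)
theory Submission
  imports Defs
begin

lemma opt_nonneg:
  assumes "online_max_problem P" "J \<in> instances P"
  shows "0 \<le> opt P J"
proof -
  obtain S where S: "S \<in> solutions P J"
    using assms unfolding online_max_problem_def by blast
  have "profit P S \<le> opt P J"
    using assms S unfolding opt_def online_max_problem_def by (intro cSUP_upper) auto
  moreover have "0 \<le> profit P S"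
    using assms S unfolding online_max_problem_def by blast
  ultimately show ?thesis by linarith
qed

text \<open>Reduces the infimum in \<open>enat\<close> to a finite condition. Only times strictly
  before \<open>r\<close> occur in it, so \<open>r\<close> may itself be the first failure: a switch
  at that very moment still comes in time.\<close>

lemma le_first_failure_iff:
  "enat r \<le> first_failure P A_off A_on \<alpha> \<beta> I t S \<longleftrightarrow>
     (\<forall>u. t < u \<and> u < r \<longrightarrow> maintains_ratio P A_off A_on \<alpha> \<beta> I t S u)"
  unfolding first_failure_def le_INF_iff by (auto simp: not_le[symmetric])

lemma total_potential_add:
  assumes "s \<le> t" "t \<le> u"
  shows "total_potential P I s u = total_potential P I s t + total_potential P I t u"
proof -
  have "{s<..u} = {s<..t} \<union> {t<..u}" using assms by auto
  moreover have "{s<..t} \<inter> {t<..u} = {}" by auto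
  ultimately show ?thesis unfolding total_potential_def by (simp add: sum.union_disjoint)
qed

lemma last_repacking_le: "last_repacking P A_off A_on \<alpha> \<beta> \<gamma> I t \<le> t"
  by (induction t) (auto simp: Let_def)

text \<open>The recursion either keeps its value or jumps to the current time. A jump after
  \<open>u\<close> would leave a value above \<open>u\<close>, so none happens between
  \<open>u\<close> and \<open>t\<close>.\<close>

lemma last_repacking_constant:
  assumes "last_repacking P A_off A_on \<alpha> \<beta> \<gamma> I t \<le> u" "u \<le> t"
  shows "last_repacking P A_off A_on \<alpha> \<beta> \<gamma> I u = last_repacking P A_off A_on \<alpha> \<beta> \<gamma> I t"
  using assms
proof (induction t)
  case (Suc t)
  then show ?case by (cases "u = Suc t") (auto simp: Let_def split: if_splits)
qed simp

text \<open>The switching is greedy: just before such an \<open>r\<close> the last switch would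
  still be \<open>l\<close>, so the recursion would jump to \<open>r\<close>, and \<open>l\<close>
  could not be the last switch at time \<open>t\<close>.\<close>

lemma no_repacking_time_since_last_repacking:
  assumes l: "l = last_repacking P A_off A_on \<alpha> \<beta> \<gamma> I t" and "r \<le> t"
  shows "\<not> repacking_time P A_off A_on \<alpha> \<beta> \<gamma> I l (A_off (I l)) r (A_off (I r))"
proof
  assume rep: "repacking_time P A_off A_on \<alpha> \<beta> \<gamma> I l (A_off (I l)) r (A_off (I r))"
  then have "l < r" unfolding repacking_time_def by simp
  then obtain r' where r': "r = Suc r'" "l \<le> r'" by (cases r) auto
  have "last_repacking P A_off A_on \<alpha> \<beta> \<gamma> I r' = l"
    using last_repacking_constant[of P A_off A_on \<alpha> \<beta> \<gamma> I t r'] r' \<open>r \<le> t\<close> l by simp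
  then have "last_repacking P A_off A_on \<alpha> \<beta> \<gamma> I r = r"
    using rep by (simp add: r')
  then show False
    using last_repacking_constant[of P A_off A_on \<alpha> \<beta> \<gamma> I t r] \<open>l < r\<close> \<open>r \<le> t\<close> l by simp
qed

context
  fixes P :: "('i, 's) online_problem"
    and A_off :: "'i \<Rightarrow> 's"
    and A_on :: "nat \<Rightarrow> 's \<Rightarrow> (nat \<Rightarrow> 'i) \<Rightarrow> nat \<Rightarrow> 's"
  assumes off: "offline_algorithm P A_off" and flex: "flexible P A_on"
begin

lemma off_solution:
  assumes "I \<in> online_instances P"
  shows "A_off (I t) \<in> solutions P (I t)"
  using off assms unfolding offline_algorithm_def online_instances_def by blast

lemma on_solution:
  assumes "I \<in> online_instances P" "t \<le> t'"
  shows "A_on t (A_off (I t)) I t' \<in> solutions P (I t')"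
  using flex assms off_solution unfolding flexible_def by blast

lemma on_cong:
  assumes "I \<in> online_instances P" "I' \<in> online_instances P" "t \<le> t'" "\<And>u. u \<le> t' \<Longrightarrow> I u = I' u"
  shows "A_on t (A_off (I t)) I t' = A_on t (A_off (I t)) I' t'"
  using flex assms off_solution[OF assms(1), of t] unfolding flexible_def by blast

lemma on_migration:
  assumes "I \<in> online_instances P" "t \<le> t'"
  shows "migration P (A_on t (A_off (I t)) I t') (A_on t (A_off (I t)) I (Suc t')) = 0"
  using flex assms off_solution unfolding flexible_def by blast

text \<open>A flexible algorithm returns its starting solution at its starting time, so the two
  branches of \<open>combined\<close> merge and later proofs avoid the case distinction.\<close>

lemma combined_eq_on:
  assumes "I \<in> online_instances P"
  shows "combined P A_off A_on \<alpha> \<beta> \<gamma> I t =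
    (let l = last_repacking P A_off A_on \<alpha> \<beta> \<gamma> I t in A_on l (A_off (I l)) I t)"
proof -
  have "A_on t (A_off (I t)) I t = A_off (I t)"
    using flex assms off_solution unfolding flexible_def by blast
  then show ?thesis by (simp add: combined_def Let_def)
qed

text \<open>This is what lets the combined algorithm decide online whether to switch. Although
  \<open>first_failure\<close> depends on the whole future, only its comparison with
  \<open>r\<close> matters, and that looks at times before \<open>r\<close>.\<close>

lemma repacking_time_cong:
  assumes I: "I \<in> online_instances P" "I' \<in> online_instances P"
    and eq: "\<And>u. u \<le> r \<Longrightarrow> I u = I' u"
  shows "repacking_time P A_off A_on \<alpha> \<beta> \<gamma> I l (A_off (I l)) r (A_off (I r)) \<longleftrightarrow>
    repacking_time P A_off A_on \<alpha> \<beta> \<gamma> I' l (A_off (I' l)) r (A_off (I' r))"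
\<comment> \<open>For \<open>l < r\<close> the two instances also agree at \<open>l\<close>;
  otherwise both sides are false.\<close>
proof (cases "l < r")
  case True
  have on: "A_on l (A_off (I l)) I u = A_on l (A_off (I' l)) I' u" if "l \<le> u" "u \<le> r" for u
    using on_cong[OF I that(1)] eq that by simp
  have "maintains_ratio P A_off A_on \<alpha> \<beta> I l (A_off (I l)) u \<longleftrightarrow>
      maintains_ratio P A_off A_on \<alpha> \<beta> I' l (A_off (I' l)) u" if "l < u" "u < r" for u
    using that on[of u] eq[of l] eq[of u] unfolding maintains_ratio_def by simp
  moreover have "total_potential P I l r = total_potential P I' l r"
    unfolding total_potential_def by (intro sum.cong) (auto simp: eq)
  ultimately show ?thesis
    using True on[of "r - 1"] eq[of r] unfolding repacking_time_def le_first_failure_iff by auto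
qed (simp add: repacking_time_def)

lemma last_repacking_cong:
  assumes "I \<in> online_instances P" "I' \<in> online_instances P" "\<And>u. u \<le> t \<Longrightarrow> I u = I' u"
  shows "last_repacking P A_off A_on \<alpha> \<beta> \<gamma> I t = last_repacking P A_off A_on \<alpha> \<beta> \<gamma> I' t"
  using assms(3)
proof (induction t)
  case (Suc t)
  then show ?case
    using repacking_time_cong[OF assms(1,2), of "Suc t"] by (simp add: Let_def)
qed simp

lemma combined_online: "online_algorithm P (combined P A_off A_on \<alpha> \<beta> \<gamma>)"
  unfolding online_algorithm_def
proof (intro conjI ballI allI impI)
  fix I t assume "I \<in> online_instances P"
  then show "combined P A_off A_on \<alpha> \<beta> \<gamma> I t \<in> solutions P (I t)"
    by (simp add: combined_eq_on Let_def on_solution last_repacking_le)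
next
  fix I I' t
  assume I: "I \<in> online_instances P" "I' \<in> online_instances P" and eq: "\<forall>u\<le>t. I u = I' u"
  define l where "l = last_repacking P A_off A_on \<alpha> \<beta> \<gamma> I t"
  have l': "last_repacking P A_off A_on \<alpha> \<beta> \<gamma> I' t = l"
    using last_repacking_cong[OF I, of t] eq unfolding l_def by simp
  have "l \<le> t" unfolding l_def by (rule last_repacking_le)
  then have "A_on l (A_off (I l)) I t = A_on l (A_off (I' l)) I' t"
    using on_cong[OF I \<open>l \<le> t\<close>] eq by simp
  then show "combined P A_off A_on \<alpha> \<beta> \<gamma> I t = combined P A_off A_on \<alpha> \<beta> \<gamma> I' t"
    using I l' by (simp add: combined_eq_on l_def[symmetric])
qed

lemma combined_competitive:
  assumes P: "online_max_problem P" and "0 \<le> \<alpha>" "\<beta> \<le> 1"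
    and approx: "approximation_ratio P A_off \<alpha>"
    and comp: "compatible P A_off A_on \<alpha> \<beta> \<gamma>"
  shows "competitive_ratio P (combined P A_off A_on \<alpha> \<beta> \<gamma>) (\<alpha> * \<beta>)"
  unfolding competitive_ratio_def
proof (intro ballI allI)
  fix I t assume I: "I \<in> online_instances P"
  have inst: "I u \<in> instances P" for u using I unfolding online_instances_def by blast
  have off_ratio: "\<alpha> * opt P (I u) \<le> profit P (A_off (I u))" for u
    using approx inst unfolding approximation_ratio_def by blast
  define l where "l = last_repacking P A_off A_on \<alpha> \<beta> \<gamma> I t"
  show "\<alpha> * \<beta> * opt P (I t) \<le> profit P (combined P A_off A_on \<alpha> \<beta> \<gamma> I t)"
  proof (cases "l = t")
    case True
    \<comment> \<open>At a switch the ratio \<alpha> is available, and it is only weakened to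
      \<alpha> * \<beta>. This uses that \<alpha> and \<open>opt\<close> are nonnegative.\<close>
    have "\<alpha> * \<beta> * opt P (I t) \<le> \<alpha> * opt P (I t)"
      using opt_nonneg[OF P inst] \<open>0 \<le> \<alpha>\<close> \<open>\<beta> \<le> 1\<close>
      by (intro mult_right_mono mult_left_le) auto
    then show ?thesis
      using off_ratio[of t] True by (simp add: combined_def l_def)
  next
    case False
    then have "l < t" using last_repacking_le[of P A_off A_on \<alpha> \<beta> \<gamma> I t] by (simp add: l_def)
    obtain r where r: "repacking_time P A_off A_on \<alpha> \<beta> \<gamma> I l (A_off (I l)) r (A_off (I r))"
      using comp I unfolding compatible_def by blast
    \<comment> \<open>Compatibility promises some \<open>r\<close>, and greediness rules out that it
      has already passed.\<close>
    then have "t < r"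
      using no_repacking_time_since_last_repacking[OF l_def] not_le by blast
    then have "maintains_ratio P A_off A_on \<alpha> \<beta> I l (A_off (I l)) t"
      using r \<open>l < t\<close> unfolding repacking_time_def le_first_failure_iff by blast
    \<comment> \<open>The phase started from the output of \<open>A_off\<close>, so the premise
      inside \<open>maintains_ratio\<close> is the approximation guarantee at time
      \<open>l\<close>.\<close>
    then show ?thesis
      using off_ratio[of l] I unfolding maintains_ratio_def
      by (simp add: combined_eq_on Let_def l_def)
  qed
qed

text \<open>
  For negative \<open>\<gamma>\<close>, compatibility forces all potentials after time 0 to vanish, since migration costs
  are nonnegative.
\<close>

lemma compatible_nonneg:
  assumes P: "online_max_problem P" and comp: "compatible P A_off A_on \<alpha> \<beta> \<gamma>"
    and I: "I \<in> online_instances P"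
  shows "0 \<le> \<gamma> * total_potential P I s t"
proof (cases "0 \<le> \<gamma>")
  case True
  have "0 \<le> total_potential P I s t"
    using P I unfolding total_potential_def online_max_problem_def online_instances_def
    by (intro sum_nonneg) blast
  with True show ?thesis by simp
next
  case False
  have inst: "I u \<in> instances P" for u using I unfolding online_instances_def by blast
  have pot: "0 \<le> potential P (I u)" for u
    using P inst unfolding online_max_problem_def by blast
  have "potential P (I u) = 0" if "s < u" for u
  proof -
    \<comment> \<open>A phase started one step before \<open>u\<close> has \<open>u\<close> in its
      potential interval, however early it ends. Since \<open>s < u\<close>, the subtraction does
      not truncate.\<close>
    define q where "q = u - 1"
    obtain r where r: "repacking_time P A_off A_on \<alpha> \<beta> \<gamma> I q (A_off (I q)) r (A_off (I r))"
      using comp I unfolding compatible_def by blast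
    have q: "q < r" "migration P (A_on q (A_off (I q)) I (r - 1)) (A_off (I r)) \<le>
        \<gamma> * total_potential P I q r"
      using r unfolding repacking_time_def by auto
    have "q \<le> r - 1" using q(1) by simp
    then have "0 \<le> migration P (A_on q (A_off (I q)) I (r - 1)) (A_off (I r))"
      using P inst on_solution[OF I, of q "r - 1"] off_solution[OF I, of r]
      unfolding online_max_problem_def by blast
    with q(2) have "0 \<le> \<gamma> * total_potential P I q r" by linarith
    with False have "total_potential P I q r \<le> 0" by (simp add: zero_le_mult_iff)
    moreover have "u \<in> {q<..r}" using q(1) \<open>s < u\<close> by (auto simp: q_def)
    then have "potential P (I u) \<le> total_potential P I q r"
      unfolding total_potential_def by (intro member_le_sum) (auto simp: pot)
    ultimately show ?thesis using pot[of u] by linarith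
  qed
  then have "total_potential P I s t = 0" unfolding total_potential_def by (intro sum.neutral) auto
  then show ?thesis by simp
qed

text \<open>Stopping the potential at the last switch strengthens the induction: the potential since
  \<open>l\<close> stays unspent, so that the next switch can be charged to all of it.\<close>

lemma combined_migration_le:
  fixes \<alpha> \<beta> \<gamma> :: real
  assumes I: "I \<in> online_instances P"
  defines "F \<equiv> combined P A_off A_on \<alpha> \<beta> \<gamma> I"
  shows "(\<Sum>u<t. migration P (F u) (F (Suc u))) \<le>
    \<gamma> * total_potential P I 0 (last_repacking P A_off A_on \<alpha> \<beta> \<gamma> I t)"
proof (induction t)
  case 0
  then show ?case by (simp add: total_potential_def)
next
  case (Suc t)
  define l where "l = last_repacking P A_off A_on \<alpha> \<beta> \<gamma> I t"
  have "l \<le> t" unfolding l_def by (rule last_repacking_le)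
  have Ft: "F t = A_on l (A_off (I l)) I t"
    using I by (simp add: F_def combined_eq_on Let_def l_def)
  show ?case
  proof (cases "repacking_time P A_off A_on \<alpha> \<beta> \<gamma> I l (A_off (I l)) (Suc t) (A_off (I (Suc t)))")
    case True
    then have last: "last_repacking P A_off A_on \<alpha> \<beta> \<gamma> I (Suc t) = Suc t"
      by (simp add: Let_def l_def)
    then have "F (Suc t) = A_off (I (Suc t))"
      by (simp add: F_def combined_def del: last_repacking.simps)
    \<comment> \<open>The repacking condition measures the cost from the solution of
      \<open>A_on\<close> one step earlier, which is exactly \<open>F t\<close>.\<close>
    then have "migration P (F t) (F (Suc t)) \<le> \<gamma> * total_potential P I l (Suc t)"
      using True unfolding repacking_time_def Ft by simp
    moreover have "total_potential P I 0 (Suc t) =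
        total_potential P I 0 l + total_potential P I l (Suc t)"
      using \<open>l \<le> t\<close> by (intro total_potential_add) auto
    ultimately show ?thesis
      using Suc.IH unfolding last l_def[symmetric] by (simp add: algebra_simps)
  next
    case False
    then have last: "last_repacking P A_off A_on \<alpha> \<beta> \<gamma> I (Suc t) = l"
      by (simp add: Let_def l_def)
    then have "F (Suc t) = A_on l (A_off (I l)) I (Suc t)"
      using I by (simp add: F_def combined_eq_on Let_def del: last_repacking.simps)
    then have "migration P (F t) (F (Suc t)) = 0"
      using on_migration[OF I \<open>l \<le> t\<close>] unfolding Ft by simp
    then show ?thesis
      using Suc.IH unfolding last l_def[symmetric] by simp
  qed
qed

lemma combined_amortized_migration:
  assumes "online_max_problem P" "compatible P A_off A_on \<alpha> \<beta> \<gamma>"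
  shows "amortized_migration_factor P (combined P A_off A_on \<alpha> \<beta> \<gamma>) \<gamma>"
  unfolding amortized_migration_factor_def
proof (intro ballI allI)
  fix I t assume I: "I \<in> online_instances P"
  define l where "l = last_repacking P A_off A_on \<alpha> \<beta> \<gamma> I t"
  have "total_potential P I 0 t = total_potential P I 0 l + total_potential P I l t"
    by (intro total_potential_add) (simp_all add: l_def last_repacking_le)
  \<comment> \<open>Dropping the unfinished phase needs the sign of its product with \<gamma>, which
    compatibility secures even for negative \<gamma>.\<close>
  then have "\<gamma> * total_potential P I 0 l \<le> \<gamma> * total_potential P I 0 t"
    using compatible_nonneg[OF assms I, of l t] by (simp add: distrib_left)
  then show "(\<Sum>u<t. migration P (combined P A_off A_on \<alpha> \<beta> \<gamma> I u)
      (combined P A_off A_on \<alpha> \<beta> \<gamma> I (Suc u))) \<le> \<gamma> * total_potential P I 0 t"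
    using combined_migration_le[OF I, of \<alpha> \<beta> \<gamma> t] unfolding l_def by linarith
qed

end

theorem theorem24:
  fixes P :: "('i, 's) online_problem"
    and A_off :: "'i \<Rightarrow> 's"
    and A_on :: "nat \<Rightarrow> 's \<Rightarrow> (nat \<Rightarrow> 'i) \<Rightarrow> nat \<Rightarrow> 's"
    and \<alpha> \<beta> \<gamma> :: real
  assumes "online_max_problem P"
    and "0 \<le> \<alpha>" and "\<beta> \<le> 1"
    and "offline_algorithm P A_off" and "approximation_ratio P A_off \<alpha>"
    and "flexible P A_on"
    and "compatible P A_off A_on \<alpha> \<beta> \<gamma>"
  defines "F \<equiv> combined P A_off A_on \<alpha> \<beta> \<gamma>"
  shows "online_algorithm P F \<and> competitive_ratio P F (\<alpha> * \<beta>)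
    \<and> amortized_migration_factor P F \<gamma>"
  unfolding F_def
  using assms(1-7) by (intro conjI combined_online combined_competitive combined_amortized_migration)

end
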